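(* Let $a,b$ be nonzero real numbers. The generating function of the bi-periodic Fibonacci matrix sequence is $$\sum_{i=0}^{\infty}\mathcal{F}_i(a,b)\,x^i=\frac{1}{1-(ab+2)x^2+x^4}\begin{pmatrix}1+bx-x^2 & \frac{b}{a}x+bx^2-\frac{b}{a}x^3\\ x+ax^2-x^3 & 1-(ab+1)x^2+bx^3\end{pmatrix}.$$
   Context: Fix nonzero real numbers $a,b$. The bi-periodic Fibonacci matrix sequence $(\mathcal{F}_n(a,b))_{n\ge 0}$ of $2\times 2$ real matrices is defined by $\mathcal{F}_0(a,b)=\begin{pmatrix}1&0\\0&1\end{pmatrix}$, $\mathcal{F}_1(a,b)=\begin{pmatrix}b&\frac{b}{a}\\1&0\end{pmatrix}$, and for $n\ge 2$: $\mathcal{F}_n(a,b)=a\mathcal{F}_{n-1}(a,b)+\mathcal{F}_{n-2}(a,b)$ if $n$ is even, $\mathcal{F}_n(a,b)=b\mathcal{F}_{n-1}(a,b)+\mathcal{F}_{n-2}(a,b)$ if $n$ is odd. The generating function is understood as a formal power series in $x$ with $2\times 2$ matrix coefficients (equivalently, entrywise). *)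

theory Defs
  imports "HOL-Analysis.Analysis"
begin

fun biperiodic_fib_matrix :: "real \<Rightarrow> real \<Rightarrow> nat \<Rightarrow> real^2^2" where
  "biperiodic_fib_matrix a b 0 = mat 1"
| "biperiodic_fib_matrix a b (Suc 0) = vector [vector [b, b / a], vector [1, 0]]"
| "biperiodic_fib_matrix a b (Suc (Suc n)) =
     (if even (Suc (Suc n)) then a else b) *\<^sub>R biperiodic_fib_matrix a b (Suc n)
       + biperiodic_fib_matrix a b n"

text \<open>A power series with matrix coefficients is read entrywise as a matrix of power series.
  The products of the library types \<open>real^2^2\<close> and hence \<open>(real^2^2) fps\<close> are based on
  componentwise multiplication of matrices, so identities that involve scalar power series
  are stated for matrices over \<open>real fps\<close> instead.\<close>

definition fps_entries :: "('a::zero^'n^'m) fps \<Rightarrow> 'a fps^'n^'m" where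
  "fps_entries G = (\<chi> i j. Abs_fps (\<lambda>n. fps_nth G n $ i $ j))"

definition generating_function :: "(nat \<Rightarrow> 'a::zero^'n^'m) \<Rightarrow> 'a fps^'n^'m" where
  "generating_function F = fps_entries (Abs_fps F)"

definition matrix_scale :: "'a::times \<Rightarrow> 'a^'n^'m \<Rightarrow> 'a^'n^'m" where
  "matrix_scale c A = map_matrix (\<lambda>x. c * x) A"

end

theory Submission
  imports Defs
begin

text \<open>The recurrence alternates between the coefficients \<open>a\<close> and \<open>b\<close>, but its even and odd parts
  obey a common recurrence with constant coefficients. Let \<open>q\<close> be the coefficient that produces
  the terms with the parity of \<open>n\<close> and \<open>p\<close> the other one. Three consecutive steps read
  \<open>F (n + 4) = q F (n + 3) + F (n + 2)\<close>, \<open>F (n + 3) = p F (n + 2) + F (n + 1)\<close> and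
  \<open>F (n + 2) = q F (n + 1) + F n\<close>. Eliminating the two terms of the other parity leaves
  \<open>F (n + 4) = (p q + 2) F (n + 2) - F n\<close>, and \<open>p q = a b\<close> for either parity
  (\<open>biperiodic_fib_matrix_step_two\<close>).

  In each entry, multiplying the power series by \<open>1 - (a b + 2) X\<^sup>2 + X\<^sup>4\<close> therefore annihilates
  every coefficient from \<open>X\<^sup>4\<close> on (\<open>fps_step_two_recurrence\<close>). What is left is a polynomial of
  degree at most 3 determined by \<open>F 0\<close>, \<open>F 1\<close>, \<open>F 2\<close> and \<open>F 3\<close>, and these polynomials are the
  entries of the numerator matrix.\<close>

lemma biperiodic_fib_matrix_rec:
  "biperiodic_fib_matrix a b (n + 2) =
     (if even n then a else b) *\<^sub>R biperiodic_fib_matrix a b (n + 1) + biperiodic_fib_matrix a b n"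
  by simp

text \<open>The coefficients \<open>a\<close> and \<open>b\<close> enter only through their product, so the parity of \<open>n\<close> no
  longer matters and the recurrence can be turned into a single rational generating function.\<close>

lemma biperiodic_fib_matrix_step_two:
  "biperiodic_fib_matrix a b (n + 4) =
     (a * b + 2) *\<^sub>R biperiodic_fib_matrix a b (n + 2) - biperiodic_fib_matrix a b n"
proof -
  let ?F = "biperiodic_fib_matrix a b"
  \<comment> \<open>Index \<open>n + 2\<close> has the parity of \<open>n\<close>, so \<open>q\<close> leads to \<open>n + 2\<close> and \<open>n + 4\<close>, and \<open>p\<close> to \<open>n + 3\<close>.\<close>
  define p q where "p = (if even n then b else a)" and "q = (if even n then a else b)"
  have Suc4: "n + 4 = Suc (Suc (Suc (Suc n)))"
    by simp
  have F2: "?F (n + 2) = q *\<^sub>R ?F (n + 1) + ?F n"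
    unfolding q_def by (rule biperiodic_fib_matrix_rec)
  have F3: "?F (n + 3) = p *\<^sub>R ?F (n + 2) + ?F (n + 1)"
    using biperiodic_fib_matrix_rec[of a b "n + 1"]
    by (simp add: p_def numeral_3_eq_3 del: biperiodic_fib_matrix.simps)
  have F4: "?F (n + 4) = q *\<^sub>R ?F (n + 3) + ?F (n + 2)"
    using biperiodic_fib_matrix_rec[of a b "n + 2"]
    by (simp add: q_def numeral_3_eq_3 Suc4 del: biperiodic_fib_matrix.simps)
  have "?F (n + 4) = (p * q + 1) *\<^sub>R ?F (n + 2) + q *\<^sub>R ?F (n + 1)"
    by (simp add: F4 F3 algebra_simps del: biperiodic_fib_matrix.simps)
  also have "q *\<^sub>R ?F (n + 1) = ?F (n + 2) - ?F n"
    by (simp only: F2 add_diff_cancel_right')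
  also have "p * q = a * b"
    by (simp add: p_def q_def)
  finally show ?thesis
    by (simp add: scaleR_left_distrib scaleR_2 add_diff_eq add.assoc del: biperiodic_fib_matrix.simps)
qed

text \<open>The recurrence says that the product of the series with \<open>1 - c X\<^sup>2 + X\<^sup>4\<close> has no terms beyond
  \<open>X\<^sup>3\<close>. That polynomial has constant coefficient 1, so it is a unit of the ring of power series
  and may be divided by.\<close>

lemma fps_step_two_recurrence:
  fixes f :: "nat \<Rightarrow> 'a::field"
  assumes rec: "\<And>n. f (n + 4) = c * f (n + 2) - f n"
  shows "Abs_fps f = 1 / (1 - fps_const c * fps_X ^ 2 + fps_X ^ 4) *
    (fps_const (f 0) + fps_const (f 1) * fps_X + fps_const (f 2 - c * f 0) * fps_X ^ 2
      + fps_const (f 3 - c * f 1) * fps_X ^ 3)"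
    (is "_ = 1 / ?D * ?N")
proof -
  have "Abs_fps f * ?D = Abs_fps f - fps_const c * (fps_X ^ 2 * Abs_fps f) + fps_X ^ 4 * Abs_fps f"
    by (simp add: algebra_simps)
  also have "\<dots> = ?N"
  proof (rule fps_ext)
    fix n :: nat
    consider "n = 0" | "n = 1" | "n = 2" | "n = 3" | m where "n = m + 4"
    proof -
      have "n = 0 \<or> n = 1 \<or> n = 2 \<or> n = 3 \<or> n = (n - 4) + 4"
        by linarith
      then show thesis
        using that by blast
    qed
    then show "fps_nth (Abs_fps f - fps_const c * (fps_X ^ 2 * Abs_fps f) + fps_X ^ 4 * Abs_fps f) n
      = fps_nth ?N n"
    proof cases
      case (5 m)
      then show ?thesis
        using rec[of m] by (simp add: fps_X_power_mult_nth)
    qed (simp_all add: fps_X_power_mult_nth)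
  qed
  finally have "Abs_fps f * ?D = ?N" .
  moreover have "fps_nth ?D 0 \<noteq> 0"
    by simp
  ultimately have "Abs_fps f = ?N * inverse ?D"
    by (metis inverse_mult_eq_1' mult.assoc mult.right_neutral)
  also have "\<dots> = 1 / ?D * ?N"
    by (subst fps_divide_unit) (simp_all add: mult.commute)
  finally show ?thesis .
qed

theorem theorem2p5:
  fixes a b :: real
  assumes "a \<noteq> 0" and "b \<noteq> 0"
  shows "generating_function (biperiodic_fib_matrix a b) =
    matrix_scale (1 / (1 - fps_const (a * b + 2) * fps_X ^ 2 + fps_X ^ 4))
      (vector
        [vector [1 + fps_const b * fps_X - fps_X ^ 2,
                 fps_const (b / a) * fps_X + fps_const b * fps_X ^ 2 - fps_const (b / a) * fps_X ^ 3],
         vector [fps_X + fps_const a * fps_X ^ 2 - fps_X ^ 3,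
                 1 - fps_const (a * b + 1) * fps_X ^ 2 + fps_const b * fps_X ^ 3]])"
    (is "_ = matrix_scale (1 / ?D) ?N")
proof -
  let ?F = "biperiodic_fib_matrix a b"
  have entry: "Abs_fps (\<lambda>n. ?F n $ i $ j) = 1 / ?D *
      (fps_const (?F 0 $ i $ j) + fps_const (?F 1 $ i $ j) * fps_X
       + fps_const (?F 2 $ i $ j - (a * b + 2) * ?F 0 $ i $ j) * fps_X ^ 2
       + fps_const (?F 3 $ i $ j - (a * b + 2) * ?F 1 $ i $ j) * fps_X ^ 3)" for i j
    by (rule fps_step_two_recurrence)
      (simp add: biperiodic_fib_matrix_step_two del: biperiodic_fib_matrix.simps)
  have F0: "?F 0 = mat 1" and F1: "?F 1 = vector [vector [b, b / a], vector [1, 0]]"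
    by simp_all
  have F2: "?F 2 = a *\<^sub>R ?F 1 + ?F 0"
    using biperiodic_fib_matrix_rec[of a b 0]
    by (simp add: numeral_2_eq_2 del: biperiodic_fib_matrix.simps)
  have F3: "?F 3 = b *\<^sub>R ?F 2 + ?F 1"
    using biperiodic_fib_matrix_rec[of a b 1]
    by (simp add: numeral_3_eq_3 numeral_2_eq_2 del: biperiodic_fib_matrix.simps)
  have numerator: "fps_const (?F 0 $ i $ j) + fps_const (?F 1 $ i $ j) * fps_X
       + fps_const (?F 2 $ i $ j - (a * b + 2) * ?F 0 $ i $ j) * fps_X ^ 2
       + fps_const (?F 3 $ i $ j - (a * b + 2) * ?F 1 $ i $ j) * fps_X ^ 3 = ?N $ i $ j" for i j
    unfolding F3 F2 F1 F0
    using exhaust_2[of i] exhaust_2[of j] assms(1)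
    by (auto intro!: fps_ext simp: mat_def fps_X_power_nth field_simps)
  have "Abs_fps (\<lambda>n. ?F n $ i $ j) = 1 / ?D * ?N $ i $ j" for i j
    unfolding entry numerator ..
  then show ?thesis
    by (simp add: generating_function_def fps_entries_def matrix_scale_def map_matrix_def
        vec_eq_iff)
qed

end
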